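(* Let $(\Omega,\sigma)$ be a minimal continuous flow on a compact metric space, let $m\in\mathfrak{M}_{\mathrm{erg}}(\Omega,\sigma)$, and assume that $a\in\mathcal{R}_m(\Omega)$. Let $\Omega^a\subseteq\Omega$ and $H_a:\Omega\to[0,1]$ be the associated set and function (defined in the context), and for $\omega\in\Omega^a$ and $\varepsilon\in(0,1)$ let $$\mathcal{I}_\varepsilon(\omega):=\{t\ge0 : H_a(\omega\cdot t)/H_a(\omega)\le\varepsilon\},\qquad \mathcal{D}_\varepsilon(\omega):=\{t\ge0 : H_a(\omega\cdot t)/H_a(\omega)\ge1-\varepsilon\}.$$ Then, for every $\varepsilon\in(0,1)$ there exists a subset $\Omega_\varepsilon\subseteq\Omega^a$ with $m(\Omega_\varepsilon)=1$ such that, for any $\omega\in\Omega_\varepsilon$: (i) the set $\mathcal{I}_\varepsilon(\omega)$ has positive lower density and is relatively dense in $\mathbb{R}^+$; (ii) the set $\mathcal{D}_\varepsilon(\omega)$ has positive lower density.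
   Context: Write $\omega\cdot t:=\sigma(t,\omega)$. The flow is minimal if $\Omega$ contains no proper nonempty compact $\sigma$-invariant subset. $\mathfrak{M}_{\mathrm{erg}}(\Omega,\sigma)$ is the set of $\sigma$-ergodic Borel probability measures. A continuous $a:\Omega\to\mathbb{R}$ admits a continuous primitive if there is a continuous $h_a:\Omega\to\mathbb{R}$ with $h_a(\omega\cdot t)-h_a(\omega)=\int_0^t a(\omega\cdot s)\,ds$ for all $\omega\in\Omega$, $t\in\mathbb{R}$. $\mathcal{R}_m(\Omega)$ is the set of continuous functions $a:\Omega\to\mathbb{R}$ with $\int_\Omega a\,dm=0$ which do not admit a continuous primitive and satisfy $\sup_{t\le 0}\int_0^t a(\omega\cdot s)\,ds<\infty$ for $m$-a.e. $\omega\in\Omega$. For $a\in\mathcal{R}_m(\Omega)$, $\Omega^a$ is the set of those $\omega\in\Omega$ with $\sup_{t\in\mathbb{R}}\int_0^t a(\omega\cdot s)\,ds<\infty$, $\inf_{t\le0}\int_0^t a(\omega\cdot s)\,ds=-\infty$ and $\inf_{t\ge0}\int_0^t a(\omega\cdot s)\,ds=-\infty$; it is $\sigma$-invariant with $m(\Omega^a)=1$. The function $H_a$ is $H_a(\omega):=\inf_{t\in\mathbb{R}}\exp\big(-\int_0^t a(\omega\cdot s)\,ds\big)\in[0,1]$; it is upper semicontinuous, satisfies $H_a(\omega\cdot t)=H_a(\omega)\exp\big(\int_0^t a(\omega\cdot s)\,ds\big)$ for all $\omega\in\Omega$, $t\in\mathbb{R}$, and $H_a(\omega)>0$ if and only if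 $\omega\in\Omega^a$. The lower density of $\mathcal{C}\subset[0,\infty)$ is $d_l(\mathcal{C})=\liminf_{t\to\infty}\frac1t\,l([0,t]\cap\mathcal{C})$, with $l$ the Lebesgue measure. A set $\mathcal{C}\subseteq\mathbb{R}^+$ is relatively dense in $\mathbb{R}^+$ if there is $L>0$ such that $[s,s+L]\cap\mathcal{C}\ne\emptyset$ for every $s\in\mathbb{R}^+$. *)

theory Defs
  imports "HOL-Probability.Probability"
begin

text \<open>The phase space is the whole type \<^typ>\<open>'a\<close>; \<open>\<sigma> t \<omega>\<close> stands for $\omega \cdot t$.\<close>

definition continuous_flow :: "(real \<Rightarrow> 'a::topological_space \<Rightarrow> 'a) \<Rightarrow> bool" where
  "continuous_flow \<sigma> \<longleftrightarrow>
     continuous_on UNIV (\<lambda>(t, \<omega>). \<sigma> t \<omega>) \<and>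
     (\<forall>\<omega>. \<sigma> 0 \<omega> = \<omega>) \<and>
     (\<forall>s t \<omega>. \<sigma> (s + t) \<omega> = \<sigma> t (\<sigma> s \<omega>))"

definition flow_invariant :: "(real \<Rightarrow> 'a \<Rightarrow> 'a) \<Rightarrow> 'a set \<Rightarrow> bool" where
  "flow_invariant \<sigma> A \<longleftrightarrow> (\<forall>t. \<sigma> t ` A = A)"

definition minimal_flow :: "(real \<Rightarrow> 'a::topological_space \<Rightarrow> 'a) \<Rightarrow> bool" where
  "minimal_flow \<sigma> \<longleftrightarrow>
     continuous_flow \<sigma> \<and>
     \<not> (\<exists>K. K \<subset> UNIV \<and> K \<noteq> {} \<and> compact K \<and> flow_invariant \<sigma> K)"

definition ergodic_measures :: "(real \<Rightarrow> 'a::topological_space \<Rightarrow> 'a) \<Rightarrow> 'a measure set" where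
  "ergodic_measures \<sigma> =
     {m. prob_space m \<and> sets m = sets borel \<and>
         (\<forall>t. distr m m (\<sigma> t) = m) \<and>
         (\<forall>A\<in>sets m. flow_invariant \<sigma> A \<longrightarrow> measure m A = 0 \<or> measure m A = 1)}"

text \<open>The interval integral is oriented, so for \<open>t < 0\<close> this is minus the integral over
  \<open>[t, 0]\<close>.\<close>

definition orbit_integral :: "(real \<Rightarrow> 'a \<Rightarrow> 'a) \<Rightarrow> ('a \<Rightarrow> real) \<Rightarrow> 'a \<Rightarrow> real \<Rightarrow> real" where
  "orbit_integral \<sigma> a \<omega> t = (LBINT s=ereal 0..ereal t. a (\<sigma> s \<omega>))"

definition has_continuous_primitive ::
    "(real \<Rightarrow> 'a::topological_space \<Rightarrow> 'a) \<Rightarrow> ('a \<Rightarrow> real) \<Rightarrow> bool" where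
  "has_continuous_primitive \<sigma> a \<longleftrightarrow>
     (\<exists>h :: 'a \<Rightarrow> real. continuous_on UNIV h \<and>
        (\<forall>\<omega> t. h (\<sigma> t \<omega>) - h \<omega> = orbit_integral \<sigma> a \<omega> t))"

text \<open>Possibly infinite suprema and infima are taken in \<^typ>\<open>ereal\<close>.\<close>

definition R_class ::
    "(real \<Rightarrow> 'a::topological_space \<Rightarrow> 'a) \<Rightarrow> 'a measure \<Rightarrow> ('a \<Rightarrow> real) set" where
  "R_class \<sigma> m =
     {a. continuous_on UNIV a \<and> (\<integral>\<omega>. a \<omega> \<partial>m) = 0 \<and>
         \<not> has_continuous_primitive \<sigma> a \<and>
         (AE \<omega> in m. (SUP t\<in>{..0}. ereal (orbit_integral \<sigma> a \<omega> t)) < \<infinity>)}"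

definition Omega_set :: "(real \<Rightarrow> 'a \<Rightarrow> 'a) \<Rightarrow> ('a \<Rightarrow> real) \<Rightarrow> 'a set" where
  "Omega_set \<sigma> a =
     {\<omega>. (SUP t. ereal (orbit_integral \<sigma> a \<omega> t)) < \<infinity> \<and>
          (INF t\<in>{..0}. ereal (orbit_integral \<sigma> a \<omega> t)) = -\<infinity> \<and>
          (INF t\<in>{0..}. ereal (orbit_integral \<sigma> a \<omega> t)) = -\<infinity>}"

definition H_fun :: "(real \<Rightarrow> 'a \<Rightarrow> 'a) \<Rightarrow> ('a \<Rightarrow> real) \<Rightarrow> 'a \<Rightarrow> real" where
  "H_fun \<sigma> a \<omega> = (INF t. exp (- orbit_integral \<sigma> a \<omega> t))"

definition I_set :: "(real \<Rightarrow> 'a \<Rightarrow> 'a) \<Rightarrow> ('a \<Rightarrow> real) \<Rightarrow> real \<Rightarrow> 'a \<Rightarrow> real set" where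
  "I_set \<sigma> a \<epsilon> \<omega> = {t. t \<ge> 0 \<and> H_fun \<sigma> a (\<sigma> t \<omega>) / H_fun \<sigma> a \<omega> \<le> \<epsilon>}"

definition D_set :: "(real \<Rightarrow> 'a \<Rightarrow> 'a) \<Rightarrow> ('a \<Rightarrow> real) \<Rightarrow> real \<Rightarrow> 'a \<Rightarrow> real set" where
  "D_set \<sigma> a \<epsilon> \<omega> = {t. t \<ge> 0 \<and> H_fun \<sigma> a (\<sigma> t \<omega>) / H_fun \<sigma> a \<omega> \<ge> 1 - \<epsilon>}"

definition lower_density :: "real set \<Rightarrow> ereal" where
  "lower_density C = Liminf at_top (\<lambda>t::real. ereal (1 / t * measure lebesgue ({0..t} \<inter> C)))"

definition relatively_dense :: "real set \<Rightarrow> bool" where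
  "relatively_dense C \<longleftrightarrow> (\<exists>L>0. \<forall>s\<ge>0. {s..s + L} \<inter> C \<noteq> {})"

end

theory Submission
  imports Defs
begin

text \<open>
  Write \<open>A \<omega> t\<close> for the integral of \<open>a\<close> along the orbit of \<open>\<omega>\<close> from time \<open>0\<close> to \<open>t\<close>, and
  \<open>H \<omega> = inf\<^sub>t exp (- A \<omega> t)\<close>.  The ratio \<open>H (\<omega>\<cdot>t) / H \<omega>\<close> is compared with a constant, so for
  fixed \<open>\<omega>\<close> the sets in question are the times that the orbit of \<open>\<omega>\<close> spends in a sublevel set,
  respectively a superlevel set, of \<open>H\<close>.  Three facts then give the result.

  First, almost every orbit has \<open>A \<omega>\<close> bounded above on all of the time axis.  Its supremum \<open>s \<omega>\<close>
  over the past is finite by hypothesis, and the supremum up to time \<open>1\<close> is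
  \<open>s (\<omega>\<cdot>1) + A \<omega> 1 \<ge> s \<omega>\<close>.  By invariance of the measure and \<open>\<integral>a = 0\<close> the difference of the two
  sides has formally the integral \<open>0\<close>; Fatou's lemma applied to truncations of \<open>s\<close> makes this an
  upper bound, so the inequality is an equality almost everywhere, and moving the time forward
  never raises the supremum (\<open>AE_bounded_above\<close>).  Because \<open>a\<close> has no continuous primitive, the
  Gottschalk--Hedlund theorem (\<open>gottschalk_hedlund\<close>) forbids \<open>A \<omega>\<close> to be bounded on a half line, so
  that \<open>A \<omega>\<close> is unbounded below in both directions of time.

  Second, \<open>H\<close> is upper semicontinuous, so \<open>{H < \<delta>}\<close> is open, and it is nonempty because \<open>A \<omega>\<close>
  takes arbitrarily negative values.  Minimality and compactness make every orbit meet it with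
  bounded gaps (\<open>minimal_bounded_gaps\<close>) and give it positive measure.

  Third, an orbit spends a positive lower proportion of time in a set of positive measure
  (\<open>AE_linear_occupation\<close>).  Only positivity of the lower density is claimed, so a covering argument
  in the style of Katznelson and Weiss (\<open>covering_average_le\<close>) replaces the pointwise ergodic
  theorem.  For the sublevel sets this is applied to \<open>{H < 1 / j}\<close> for all \<open>j \<ge> 1\<close>.  For the
  superlevel sets it is applied to \<open>{H \<ge> q}\<close> for all rational \<open>q\<close>, in the form that almost
  every point of any measurable set returns to it with positive lower density; for a given \<open>\<omega>\<close> one
  picks \<open>q\<close> strictly between \<open>(1 - \<epsilon>) H \<omega>\<close> and \<open>H \<omega>\<close>, and \<open>\<omega>\<close> itself lies in \<open>{H \<ge> q}\<close>.
\<close>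

section \<open>Minimal flows on compact spaces\<close>

locale compact_flow =
  fixes \<sigma> :: "real \<Rightarrow> 'a::metric_space \<Rightarrow> 'a"
  assumes compact_space: "compact (UNIV :: 'a set)"
    and flow: "continuous_flow \<sigma>"
begin

lemma flow_zero [simp]: "\<sigma> 0 \<omega> = \<omega>"
  using flow by (simp add: continuous_flow_def)

lemma flow_flow: "\<sigma> t (\<sigma> s \<omega>) = \<sigma> (s + t) \<omega>"
  using flow by (simp add: continuous_flow_def)

lemma continuous_on_flow [continuous_intros]:
  assumes "continuous_on S f" and "continuous_on S g"
  shows "continuous_on S (\<lambda>x. \<sigma> (f x) (g x))"
proof -
  have "continuous_on S ((\<lambda>(t, \<omega>). \<sigma> t \<omega>) \<circ> (\<lambda>x. (f x, g x)))"
    using flow assms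
    by (intro continuous_on_compose continuous_intros)
       (auto simp: continuous_flow_def intro: continuous_on_subset)
  then show ?thesis by (simp add: o_def)
qed

lemma flow_vimage_image: "\<sigma> t ` A = \<sigma> (- t) -` A"
proof
  show "\<sigma> t ` A \<subseteq> \<sigma> (- t) -` A" by (auto simp: flow_flow)
  show "\<sigma> (- t) -` A \<subseteq> \<sigma> t ` A"
  proof
    fix \<omega> assume "\<omega> \<in> \<sigma> (- t) -` A"
    then show "\<omega> \<in> \<sigma> t ` A" by (intro image_eqI[of _ _ "\<sigma> (- t) \<omega>"]) (auto simp: flow_flow)
  qed
qed

lemma flow_invariantI:
  assumes "\<And>\<omega> t. \<omega> \<in> A \<Longrightarrow> \<sigma> t \<omega> \<in> A"
  shows "flow_invariant \<sigma> A"
  unfolding flow_invariant_def flow_vimage_image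
proof (intro allI equalityI subsetI)
  fix t \<omega> assume "\<omega> \<in> \<sigma> (- t) -` A"
  then have "\<sigma> t (\<sigma> (- t) \<omega>) \<in> A" using assms by auto
  then show "\<omega> \<in> A" by (simp add: flow_flow)
qed (use assms in auto)

lemma open_flow_vimage: "open U \<Longrightarrow> open (\<sigma> t -` U)"
  by (intro open_vimage continuous_intros)

text \<open>The points whose orbit avoids \<open>U\<close> form a compact invariant set, which minimality forces to be
  empty; hence the preimages of \<open>U\<close> cover the space.\<close>

lemma minimal_finite_cover:
  assumes min: "minimal_flow \<sigma>" and U: "open U" "U \<noteq> {}"
  obtains F where "finite F" "(\<Union>t\<in>F. \<sigma> t -` U) = UNIV"
proof -
  define K where "K = {\<omega>. \<forall>t. \<sigma> t \<omega> \<notin> U}"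
  have K: "K = - (\<Union>t. \<sigma> t -` U)" by (auto simp: K_def)
  have "closed K" unfolding K using U by (intro closed_Compl open_UN ballI open_flow_vimage)
  then have "compact K" using compact_space compact_Int_closed[of UNIV K] by simp
  moreover have "flow_invariant \<sigma> K"
    by (rule flow_invariantI) (auto simp: K_def flow_flow)
  moreover have "K \<noteq> UNIV" using U flow_zero unfolding K_def by (metis (mono_tags) UNIV_I all_not_in_conv mem_Collect_eq)
  ultimately have "K = {}" using min unfolding minimal_flow_def by blast
  then have "UNIV \<subseteq> (\<Union>t\<in>UNIV. \<sigma> t -` U)" by (auto simp: K_def)
  then obtain F where "finite F" "UNIV \<subseteq> (\<Union>t\<in>F. \<sigma> t -` U)"
    using compactE_image[OF compact_space, of UNIV "\<lambda>t. \<sigma> t -` U"] U open_flow_vimage by metis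
  then show ?thesis using that by blast
qed

text \<open>The finitely many times of the cover lie in some interval \<open>[-M, M]\<close>.  Applying the cover at the
  point reached at time \<open>s + M\<close> moves this window to \<open>[s, s + 2 * M]\<close>.\<close>

lemma minimal_bounded_gaps:
  assumes min: "minimal_flow \<sigma>" and U: "open U" "U \<noteq> {}"
  obtains L where "L > 0" "\<And>\<omega> s. \<exists>t\<in>{s..s + L}. \<sigma> t \<omega> \<in> U"
proof -
  obtain F where F: "finite F" "(\<Union>t\<in>F. \<sigma> t -` U) = UNIV"
    using minimal_finite_cover[OF assms] .
  then have "bounded F" by (simp add: finite_imp_bounded)
  then obtain M where M: "M > 0" "\<And>t. t \<in> F \<Longrightarrow> \<bar>t\<bar> \<le> M"
    unfolding bounded_pos by auto
  show ?thesis
  proof (rule that[of "2 * M"])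
    fix \<omega> s
    obtain t where "t \<in> F" "\<sigma> t (\<sigma> (s + M) \<omega>) \<in> U" using F(2) by blast
    then show "\<exists>t\<in>{s..s + 2 * M}. \<sigma> t \<omega> \<in> U"
      using M(2)[of t] by (intro bexI[of _ "s + M + t"]) (auto simp: flow_flow)
  qed (use M in auto)
qed

end

section \<open>The additive cocycle of a continuous function\<close>

locale cocycle_flow = compact_flow \<sigma> for \<sigma> :: "real \<Rightarrow> 'a::metric_space \<Rightarrow> 'a" +
  fixes a :: "'a \<Rightarrow> real"
  assumes continuous_a: "continuous_on UNIV a"
begin

abbreviation A :: "'a \<Rightarrow> real \<Rightarrow> real" where "A \<equiv> orbit_integral \<sigma> a"

lemma continuous_on_a_flow [continuous_intros]:
  assumes "continuous_on S f" and "continuous_on S g"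
  shows "continuous_on S (\<lambda>x. a (\<sigma> (f x) (g x)))"
  using continuous_on_compose2[OF continuous_a continuous_on_flow[OF assms]] by simp

lemma interval_integrable_along_orbit:
  "interval_lebesgue_integrable lborel (ereal s) (ereal t) (\<lambda>u. a (\<sigma> (r + u) \<omega>))"
proof -
  have le: "interval_lebesgue_integrable lborel (ereal s) (ereal t) (\<lambda>u. a (\<sigma> (r + u) \<omega>))"
    if "s \<le> t" for s t :: real
    using that by (intro interval_integrable_continuous_on continuous_intros)
  then show ?thesis
    by (metis linear interval_integrable_endpoints_reverse)
qed

lemma A_zero [simp]: "A \<omega> 0 = 0"
  by (simp add: orbit_integral_def zero_ereal_def)

lemma A_cocycle: "A \<omega> (s + t) = A \<omega> s + A (\<sigma> s \<omega>) t"
proof -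
  have shift: "(LBINT u=ereal 0..ereal t. a (\<sigma> u (\<sigma> s \<omega>))) =
    (LBINT u=ereal s..ereal (s + t). a (\<sigma> u \<omega>))"
    (is "?l = ?r")
  proof -
    have ind: "indicator {s<..<s + t} (s + x) = (indicator {0<..<t} x :: real)"
      "indicator {s + t<..<s} (s + x) = (indicator {t<..<0} x :: real)" for x
      by (auto simp: indicator_def)
    show ?thesis
      unfolding interval_lebesgue_integral_def set_lebesgue_integral_def flow_flow
      using lborel_integral_real_affine[of 1 "\<lambda>u. indicator {s<..<s + t} u *\<^sub>R a (\<sigma> u \<omega>)" s]
        lborel_integral_real_affine[of 1 "\<lambda>u. indicator {s + t<..<s} u *\<^sub>R a (\<sigma> u \<omega>)" s]
      by (simp add: ind zero_ereal_def)
  qed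
  have "A \<omega> s + ?r = A \<omega> (s + t)"
    unfolding orbit_integral_def
    using interval_integrable_along_orbit[of _ _ 0 \<omega>]
    by (intro interval_integral_sum) (auto simp flip: ereal_min ereal_max)
  then show ?thesis by (simp add: orbit_integral_def shift)
qed

lemma A_shift: "A (\<sigma> s \<omega>) t = A \<omega> (s + t) - A \<omega> s"
  by (simp add: A_cocycle)

lemma continuous_on_A: "continuous_on UNIV (\<lambda>\<omega>. A \<omega> t)"
proof -
  have nonneg: "continuous_on UNIV (\<lambda>\<omega>. A \<omega> t)" if "t \<ge> 0" for t
  proof -
    have "A \<omega> t = integral (cbox 0 t) (\<lambda>u. a (\<sigma> u \<omega>))" for \<omega>
      unfolding orbit_integral_def using that
      by (subst interval_integral_eq_integral)
         (auto intro!: borel_integrable_atLeastAtMost' continuous_intros)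
    moreover have "continuous_on (UNIV \<times> cbox 0 t) (\<lambda>(\<omega>, u). a (\<sigma> u \<omega>))"
      by (auto simp: case_prod_unfold intro!: continuous_intros)
    from integral_continuous_on_param[OF this]
    have "continuous_on UNIV (\<lambda>\<omega>. integral (cbox 0 t) (\<lambda>u. a (\<sigma> u \<omega>)))" .
    ultimately show ?thesis by simp
  qed
  show ?thesis
  proof (cases "t \<ge> 0")
    case False
    have "A \<omega> t = - A (\<sigma> t \<omega>) (- t)" for \<omega>
      using A_cocycle[of \<omega> t "- t"] by simp
    then show ?thesis
      using nonneg[of "- t"] False
      by (auto intro!: continuous_intros continuous_on_compose2[OF nonneg[of "- t"]])
  qed (use nonneg in auto)
qed

lemma open_A_greater: "open {\<omega>. c < A \<omega> t}"
  by (intro open_Collect_less continuous_intros continuous_on_A)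

lemma a_bounded: obtains K where "K \<ge> 0" "\<And>\<omega>. \<bar>a \<omega>\<bar> \<le> K"
proof -
  have "bounded (range a)"
    using compact_continuous_image[OF continuous_a compact_space] compact_imp_bounded by blast
  then obtain K where "\<forall>x\<in>range a. norm x \<le> K" unfolding bounded_iff by auto
  then have "\<And>\<omega>. \<bar>a \<omega>\<bar> \<le> K" by auto
  moreover from this have "K \<ge> 0" using abs_ge_zero order_trans by blast
  ultimately show ?thesis using that by blast
qed


lemma A_le:
  assumes "\<And>\<omega>. \<bar>a \<omega>\<bar> \<le> K" and "t \<ge> 0"
  shows "\<bar>A \<omega> t\<bar> \<le> K * t"
proof -
  have "A \<omega> t = integral {0..t} (\<lambda>u. a (\<sigma> u \<omega>))"
    unfolding orbit_integral_def using assms(2)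
    by (subst interval_integral_eq_integral)
       (auto intro!: borel_integrable_atLeastAtMost' continuous_intros)
  moreover have "norm (integral {0..t} (\<lambda>u. a (\<sigma> u \<omega>))) \<le> K * (t - 0)"
    using assms by (intro integral_bound continuous_intros) auto
  ultimately show ?thesis by simp
qed

text \<open>The condition \<open>\<bar>A \<omega> s\<bar> > 2 * C\<close> is open in \<open>\<omega>\<close>.  Were it satisfiable, the orbit of \<open>\<omega>\<^sub>0\<close> would
  satisfy it at some time \<open>t\<close> far enough in the half line \<open>J\<close> that both \<open>t\<close> and \<open>t + s\<close> belong to
  \<open>J\<close>, where the increment of \<open>A \<omega>\<^sub>0\<close> is at most \<open>2 * C\<close>.\<close>

lemma bounded_on_all_orbits:
  assumes min: "minimal_flow \<sigma>"
    and J: "J = {0..} \<or> J = {..0::real}"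
    and C: "\<And>t. t \<in> J \<Longrightarrow> \<bar>A \<omega>\<^sub>0 t\<bar> \<le> C"
  shows "\<bar>A \<omega> s\<bar> \<le> 2 * C"
proof (rule ccontr)
  define U where "U = {\<omega>. 2 * C < \<bar>A \<omega> s\<bar>}"
  assume "\<not> \<bar>A \<omega> s\<bar> \<le> 2 * C"
  then have "U \<noteq> {}" by (auto simp: U_def not_le)
  moreover have "open U"
    unfolding U_def by (intro open_Collect_less continuous_intros continuous_on_A)
  ultimately obtain L where L: "\<And>\<omega> s. \<exists>t\<in>{s..s + L}. \<sigma> t \<omega> \<in> U"
    using minimal_bounded_gaps[OF min] by metis
  obtain t where t: "\<sigma> t \<omega>\<^sub>0 \<in> U" "t \<in> J" "t + s \<in> J"
  proof (cases "J = {0..}")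
    case True
    obtain t where "t \<in> {\<bar>s\<bar>..\<bar>s\<bar> + L}" "\<sigma> t \<omega>\<^sub>0 \<in> U" using L by blast
    then show ?thesis using True by (intro that[of t]) auto
  next
    case False
    \<comment> \<open>The window of length \<open>L\<close> ends at \<open>- \<bar>s\<bar>\<close>, so that \<open>t\<close> and \<open>t + s\<close> are both nonpositive.\<close>
    obtain t where "t \<in> {- \<bar>s\<bar> - L..- \<bar>s\<bar> - L + L}" "\<sigma> t \<omega>\<^sub>0 \<in> U" using L by blast
    then show ?thesis using False J by (intro that[of t]) auto
  qed
  have "\<bar>A \<omega>\<^sub>0 (t + s) - A \<omega>\<^sub>0 t\<bar> \<le> 2 * C"
    using C[OF t(2)] C[OF t(3)] by linarith
  then show False using t(1) by (simp add: U_def A_shift)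
qed

text \<open>The Gottschalk--Hedlund theorem.  The supremum \<open>h\<close> and the infimum \<open>k\<close> of \<open>A \<omega>\<close> over all times
  both change by \<open>- A \<omega> t\<close> along the flow, and they are lower and upper semicontinuous.  Hence
  \<open>h - k\<close> is invariant and lower semicontinuous, so constant by minimality; then \<open>h\<close> is also upper
  semicontinuous, and \<open>- h\<close> is a continuous primitive.\<close>

lemma gottschalk_hedlund:
  assumes min: "minimal_flow \<sigma>"
    and J: "J = {0..} \<or> J = {..0::real}"
    and C: "\<And>t. t \<in> J \<Longrightarrow> \<bar>A \<omega>\<^sub>0 t\<bar> \<le> C"
  shows "has_continuous_primitive \<sigma> a"
proof -
  define D where "D = 2 * C"
  have D: "\<bar>A \<omega> t\<bar> \<le> D" for \<omega> t
    unfolding D_def by (rule bounded_on_all_orbits[OF assms])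
  have bdd: "bdd_above (range (A \<omega>))" "bdd_below (range (A \<omega>))" for \<omega>
    using D[of \<omega>] by (auto simp: abs_le_iff intro!: bdd_aboveI2[of _ _ D] bdd_belowI2[of _ "- D"] ) (smt (verit) D)
  define h where "h \<omega> = (SUP t. A \<omega> t)" for \<omega>
  define k where "k \<omega> = (INF t. A \<omega> t)" for \<omega>
  have less_h: "c < h \<omega> \<longleftrightarrow> (\<exists>t. c < A \<omega> t)" for c \<omega>
    unfolding h_def using bdd by (subst less_cSUP_iff) auto
  have k_less: "k \<omega> < c \<longleftrightarrow> (\<exists>t. A \<omega> t < c)" for c \<omega>
    unfolding k_def using bdd by (subst cINF_less_iff) auto
  have h_flow: "h (\<sigma> t \<omega>) = h \<omega> - A \<omega> t" for t \<omega>
  proof -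
    have "c < h (\<sigma> t \<omega>) \<longleftrightarrow> c < h \<omega> - A \<omega> t" for c
    proof -
      have "c < h (\<sigma> t \<omega>) \<longleftrightarrow> (\<exists>s. c + A \<omega> t < A \<omega> (t + s))"
        by (auto simp: less_h A_shift less_diff_eq)
      also have "\<dots> \<longleftrightarrow> (\<exists>s. c + A \<omega> t < A \<omega> s)"
        by (metis add.commute diff_add_cancel)
      finally show ?thesis by (simp add: less_h less_diff_eq flip: less_h)
    qed
    then show ?thesis by (meson less_irrefl linorder_neqE)
  qed
  have k_flow: "k (\<sigma> t \<omega>) = k \<omega> - A \<omega> t" for t \<omega>
  proof -
    have "k (\<sigma> t \<omega>) < c \<longleftrightarrow> k \<omega> - A \<omega> t < c" for c
    proof -
      have "k (\<sigma> t \<omega>) < c \<longleftrightarrow> (\<exists>s. A \<omega> (t + s) < c + A \<omega> t)"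
        by (auto simp: k_less A_shift diff_less_eq)
      also have "\<dots> \<longleftrightarrow> (\<exists>s. A \<omega> s < c + A \<omega> t)"
        by (metis add.commute diff_add_cancel)
      finally show ?thesis by (simp add: k_less diff_less_eq flip: k_less)
    qed
    then show ?thesis by (meson less_irrefl linorder_neqE)
  qed
  have le: "h \<omega> - k \<omega> \<le> h \<omega>' - k \<omega>'" for \<omega> \<omega>'
  proof (rule ccontr)
    define c where "c = h \<omega>' - k \<omega>'"
    define U where "U = {\<omega>. c < h \<omega> - k \<omega>}"
    assume "\<not> ?thesis"
    then have "U \<noteq> {}" by (auto simp: U_def c_def not_le)
    moreover have "open U"
    proof -
      have "c < h \<omega> - k \<omega> \<longleftrightarrow> (\<exists>s t. c < A \<omega> s - A \<omega> t)" for \<omega>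
      proof -
        have "c < h \<omega> - k \<omega> \<longleftrightarrow> c + k \<omega> < h \<omega>" by linarith
        also have "\<dots> \<longleftrightarrow> (\<exists>s. k \<omega> < A \<omega> s - c)"
          unfolding less_h by (simp add: less_diff_eq add.commute)
        also have "\<dots> \<longleftrightarrow> (\<exists>s t. c < A \<omega> s - A \<omega> t)"
          unfolding k_less by (simp add: less_diff_eq add.commute)
        finally show ?thesis .
      qed
      then have "U = (\<Union>s t. {\<omega>. c < A \<omega> s - A \<omega> t})" by (auto simp: U_def)
      then show ?thesis
        by (auto intro!: open_UN open_Collect_less continuous_intros continuous_on_A)
    qed
    ultimately obtain t where "\<sigma> t \<omega>' \<in> U"
      using minimal_bounded_gaps[OF min] by metis
    then show False by (simp add: U_def c_def h_flow k_flow)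
  qed
  have "continuous_on UNIV h"
    unfolding continuous_on_def
  proof (intro ballI)
    fix \<omega>
    have open_h: "open {\<eta>. c < h \<eta>}" for c
    proof -
      have "{\<eta>. c < h \<eta>} = (\<Union>t. {\<eta>. c < A \<eta> t})" by (auto simp: less_h)
      then show ?thesis by (auto intro!: open_UN open_A_greater)
    qed
    have open_k: "open {\<eta>. k \<eta> < c}" for c
    proof -
      have "{\<eta>. k \<eta> < c} = (\<Union>t. {\<eta>. A \<eta> t < c})" by (auto simp: k_less)
      then show ?thesis
        by (auto intro!: open_UN open_Collect_less continuous_intros continuous_on_A)
    qed
    have hk: "h \<eta> = k \<eta> + (h \<omega> - k \<omega>)" for \<eta> using le[of \<eta> \<omega>] le[of \<omega> \<eta>] by linarith
    show "(h \<longlongrightarrow> h \<omega>) (at \<omega>)"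
    proof (rule order_tendstoI)
      fix c assume "c < h \<omega>"
      then show "\<forall>\<^sub>F \<eta> in at \<omega>. c < h \<eta>"
        using eventually_nhds_in_open[OF open_h, of \<omega> c] by (simp add: eventually_at_filter eventually_mono)
    next
      fix c assume "h \<omega> < c"
      then have "\<forall>\<^sub>F \<eta> in nhds \<omega>. k \<eta> < c - (h \<omega> - k \<omega>)"
        using eventually_nhds_in_open[OF open_k, of \<omega> "c - (h \<omega> - k \<omega>)"] by simp
      then have "\<forall>\<^sub>F \<eta> in nhds \<omega>. h \<eta> < c"
        by (rule eventually_mono) (use hk in \<open>smt (verit)\<close>)
      then show "\<forall>\<^sub>F \<eta> in at \<omega>. h \<eta> < c"
        by (simp add: eventually_at_filter eventually_mono)
    qed
  qed
  then show ?thesis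
    unfolding has_continuous_primitive_def
    by (intro exI[of _ "\<lambda>\<omega>. - h \<omega>"]) (auto simp: h_flow intro!: continuous_intros)
qed

section \<open>The upper semicontinuous function H\<close>

abbreviation H :: "'a \<Rightarrow> real" where "H \<equiv> H_fun \<sigma> a"

text \<open>Strict upper bounds on an infimum unfold to an existential; all properties of \<open>H\<close> below are read
  off from this form, upper semicontinuity included.\<close>

lemma H_less_iff: "H \<omega> < c \<longleftrightarrow> (\<exists>t. exp (- A \<omega> t) < c)"
  unfolding H_fun_def by (subst cINF_less_iff) (auto intro!: bdd_belowI2[of _ 0])

lemma open_H_less: "open {\<omega>. H \<omega> < c}"
proof -
  have "{\<omega>. H \<omega> < c} = (\<Union>t. {\<omega>. exp (- A \<omega> t) < c})" by (auto simp: H_less_iff)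
  then show ?thesis
    by (auto intro!: open_UN open_Collect_less continuous_intros continuous_on_A)
qed

lemma H_pos:
  assumes "\<And>t. A \<omega> t \<le> C"
  shows "H \<omega> > 0"
proof -
  have "\<not> H \<omega> < exp (- C)" using assms by (auto simp: H_less_iff not_less)
  then show ?thesis by (auto simp: not_less intro: less_le_trans[OF exp_gt_zero])
qed

text \<open>Given an upper bound, a finite infimum over one of the half lines would bound \<open>A \<omega>\<close> there, and
  the Gottschalk--Hedlund theorem would yield a primitive.\<close>

lemma Omega_set_if_bounded_above:
  assumes min: "minimal_flow \<sigma>" and no_primitive: "\<not> has_continuous_primitive \<sigma> a"
    and C: "\<And>t. A \<omega> t \<le> C"
  shows "\<omega> \<in> Omega_set \<sigma> a"
proof -
  have "(SUP t. ereal (A \<omega> t)) \<le> ereal C" using C by (intro SUP_least) simp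
  then have "(SUP t. ereal (A \<omega> t)) < \<infinity>" by (rule le_less_trans) simp
  moreover have "(INF t\<in>J. ereal (A \<omega> t)) = -\<infinity>" if J: "J = {0..} \<or> J = {..0::real}" for J
  proof (rule ccontr)
    assume "(INF t\<in>J. ereal (A \<omega> t)) \<noteq> -\<infinity>"
    moreover have "(INF t\<in>J. ereal (A \<omega> t)) \<le> ereal (A \<omega> 0)" using J by (intro INF_lower) auto
    ultimately obtain c where c: "(INF t\<in>J. ereal (A \<omega> t)) = ereal c"
      by (cases "INF t\<in>J. ereal (A \<omega> t)") auto
    have "\<bar>A \<omega> t\<bar> \<le> max \<bar>c\<bar> \<bar>C\<bar>" if "t \<in> J" for t
    proof -
      have "ereal c \<le> ereal (A \<omega> t)" unfolding c[symmetric] using that by (rule INF_lower)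
      then show ?thesis using C[of t] by auto
    qed
    then show False using gottschalk_hedlund[OF min J] no_primitive by blast
  qed
  ultimately show ?thesis by (simp add: Omega_set_def)
qed

end

section \<open>Invariant measures\<close>

locale invariant_measure = compact_flow \<sigma> + prob_space m
  for \<sigma> :: "real \<Rightarrow> 'a::metric_space \<Rightarrow> 'a" and m :: "'a measure" +
  assumes sets_m [measurable_cong]: "sets m = sets borel"
    and distr_m: "\<And>t. distr m m (\<sigma> t) = m"
begin

lemma space_m [simp]: "space m = UNIV"
  using sets_eq_imp_space_eq[OF sets_m] by simp

lemma flow_measurable [measurable]: "\<sigma> t \<in> measurable m m"
proof -
  have "\<sigma> t \<in> measurable borel borel"
    by (intro borel_measurable_continuous_onI continuous_intros)
  then show ?thesis by measurable
qed

lemma open_in_sets [measurable]: "open U \<Longrightarrow> U \<in> sets m"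
  by (simp add: sets_m)

lemma continuous_measurable: "continuous_on UNIV f \<Longrightarrow> f \<in> borel_measurable m"
  for f :: "'a \<Rightarrow> 'b::topological_space"
  using borel_measurable_continuous_onI[of f] by measurable

lemma measure_vimage: "B \<in> sets m \<Longrightarrow> measure m (\<sigma> t -` B) = measure m B"
  using measure_distr[of "\<sigma> t" m m B] distr_m[of t] by simp

lemma emeasure_vimage: "B \<in> sets m \<Longrightarrow> emeasure m (\<sigma> t -` B) = emeasure m B"
  using emeasure_distr[of "\<sigma> t" m m B] distr_m[of t] by simp

lemma AE_flow: "(AE \<omega> in m. P \<omega>) \<Longrightarrow> (AE \<omega> in m. P (\<sigma> t \<omega>))"
proof -
  assume "AE \<omega> in m. P \<omega>"
  then obtain N where N: "N \<in> sets m" "emeasure m N = 0" "{\<omega>. \<not> P \<omega>} \<subseteq> N"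
    by (auto elim!: AE_E)
  show ?thesis
    by (rule AE_I[of _ _ "\<sigma> t -` N"])
       (use N emeasure_vimage[OF N(1)] measurable_sets[OF flow_measurable N(1)] in auto)
qed

text \<open>Finitely many preimages of \<open>U\<close>, all of the same measure, cover the space.\<close>

lemma positive_measure_of_open:
  assumes min: "minimal_flow \<sigma>" and U: "open U" "U \<noteq> {}"
  shows "measure m U > 0"
proof (rule ccontr)
  assume "\<not> measure m U > 0"
  then have 0: "measure m U = 0" by (simp add: zero_less_measure_iff)
  obtain F where F: "finite F" "(\<Union>t\<in>F. \<sigma> t -` U) = UNIV"
    using minimal_finite_cover[OF assms] .
  have "measure m (\<Union>t\<in>F. \<sigma> t -` U) \<le> (\<Sum>t\<in>F. measure m (\<sigma> t -` U))"
    by (intro finite_measure_subadditive_finite F) (auto intro!: open_in_sets open_flow_vimage U)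
  also have "\<dots> = 0" using U 0 by (simp add: measure_vimage)
  finally show False using prob_space F(2) by simp
qed

text \<open>Joint continuity alone does not give measurability for the product sigma-algebra unless the Borel
  sets of the product are known to be generated by rectangles.  Discretizing time avoids this: the
  flow is the pointwise limit of maps in which time takes countably many values.\<close>

lemma flow_joint_measurable: "(\<lambda>(\<omega>, s). \<sigma> s \<omega>) \<in> measurable (m \<Otimes>\<^sub>M lborel) m"
proof -
  define q :: "nat \<Rightarrow> real \<Rightarrow> real" where "q n s = real_of_int \<lfloor>real (Suc n) * s\<rfloor> / real (Suc n)" for n s
  have q: "(\<lambda>n. q n s) \<longlonglongrightarrow> s" for s
  proof (rule LIMSEQ_I)
    fix r :: real assume "r > 0"
    then obtain N where N: "N > 0" "inverse (real N) < r" using ex_inverse_of_nat_less by blast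
    have "norm (q n s - s) < r" if "n \<ge> N" for n
    proof -
      have "\<bar>q n s - s\<bar> = \<bar>real_of_int \<lfloor>real (Suc n) * s\<rfloor> - real (Suc n) * s\<bar> / real (Suc n)"
        unfolding q_def by (simp add: field_simps abs_divide del: of_nat_Suc)
      also have "\<dots> \<le> 1 / real (Suc n)"
        by (intro divide_right_mono) (linarith, simp)
      also have "\<dots> \<le> inverse (real N)"
        using that N by (simp add: field_simps)
      finally show ?thesis using N by simp
    qed
    then show "\<exists>N. \<forall>n\<ge>N. norm (q n s - s) < r" by blast
  qed
  have "(\<lambda>x. \<sigma> (snd x) (fst x)) \<in> borel_measurable (m \<Otimes>\<^sub>M lborel)"
  proof (rule borel_measurable_LIMSEQ_metric[of "\<lambda>n x. \<sigma> (q n (snd x)) (fst x)"])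
    fix n
    have "(\<lambda>x. \<sigma> (real_of_int i / real (Suc n)) (fst x)) \<in> measurable (m \<Otimes>\<^sub>M lborel) m" for i :: int
      by (rule measurable_compose[OF measurable_fst flow_measurable])
    moreover have "(\<lambda>x. \<lfloor>real (Suc n) * snd x\<rfloor>) \<in> measurable (m \<Otimes>\<^sub>M lborel) (count_space UNIV)"
      by (intro measurable_compose[OF measurable_snd measurable_compose[OF _ measurable_real_floor]]) simp
    ultimately have "(\<lambda>x. \<sigma> (real_of_int \<lfloor>real (Suc n) * snd x\<rfloor> / real (Suc n)) (fst x)) \<in> measurable (m \<Otimes>\<^sub>M lborel) m"
      by (rule measurable_compose_countable)
    then show "(\<lambda>x. \<sigma> (q n (snd x)) (fst x)) \<in> borel_measurable (m \<Otimes>\<^sub>M lborel)"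
      unfolding q_def by (simp add: measurable_cong_sets[OF refl sets_m])
  next
    fix x :: "'a \<times> real"
    have "continuous_on UNIV (\<lambda>t. \<sigma> t (fst x))" by (intro continuous_intros)
    then show "(\<lambda>n. \<sigma> (q n (snd x)) (fst x)) \<longlonglongrightarrow> \<sigma> (snd x) (fst x)"
      by (rule continuous_on_tendsto_compose[OF _ q]) auto
  qed
  then show ?thesis unfolding case_prod_unfold by measurable
qed

text \<open>The Katznelson--Weiss covering argument.  Cut an orbit segment of length \<open>L\<close> greedily into blocks:
  at a point that has a block of length at most \<open>M\<close> and average at most \<open>e\<close>, use that block; at any
  other point replace the value of \<open>f\<close> by \<open>0\<close> and use a block of length one.  Every block has average
  at most \<open>e\<close>, except for an unfinished last one that contributes at most \<open>M\<close>.  Integrate, let \<open>L\<close> tend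
  to infinity, which removes the error \<open>M / L\<close>, and then let \<open>M\<close> tend to infinity, which restores \<open>f\<close>.\<close>

lemma covering_average_le:
  fixes f :: "'a \<Rightarrow> real"
  assumes [measurable]: "T \<in> measurable m m" "f \<in> borel_measurable m"
    and T: "distr m m T = m"
    and f: "\<And>x. 0 \<le> f x" "\<And>x. f x \<le> 1" and e: "e \<ge> 0"
    and cover: "AE x in m. \<exists>n\<ge>1. (\<Sum>k<n. f ((T ^^ k) x)) \<le> e * real n"
  shows "(\<integral>x. f x \<partial>m) \<le> e"
proof -
  define S where "S n x = (\<Sum>k<n. f ((T ^^ k) x))" for n x
  have Tk [measurable]: "T ^^ k \<in> measurable m m" for k
    by (induction k) (auto simp: id_def)
  have [measurable]: "S n \<in> borel_measurable m" for n
    unfolding S_def by measurable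
  define G where "G M = {x. \<exists>n\<in>{1..M}. S n x \<le> e * real n}" for M
  have [measurable]: "G M \<in> sets m" for M
  proof -
    have "{x \<in> space m. \<exists>n\<in>{1..M}. S n x \<le> e * real n} \<in> sets m" by measurable
    then show ?thesis by (simp add: G_def)
  qed
  define g where "g M x = f x * indicator (G M) x" for M x
  have [measurable]: "g M \<in> borel_measurable m" for M unfolding g_def by measurable
  have g: "0 \<le> g M x" "g M x \<le> f x" "g M x \<le> 1" for M x
    using f[of x] by (auto simp: g_def indicator_def)
  have bound: "(\<Sum>k<L. g M ((T ^^ k) x)) \<le> e * real L + real M" for L M x
  proof (induction L arbitrary: x rule: less_induct)
    case (less L)
    have split: "(\<Sum>k<L. g M ((T ^^ k) x)) = (\<Sum>k<n. g M ((T ^^ k) x)) +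
        (\<Sum>k<L - n. g M ((T ^^ k) ((T ^^ n) x)))"
      if "n \<le> L" for n
    proof -
      have "(\<Sum>k<L. g M ((T ^^ k) x)) = (\<Sum>k<n. g M ((T ^^ k) x)) + (\<Sum>k\<in>{n..<L}. g M ((T ^^ k) x))"
        using that by (metis atLeast0LessThan sum.atLeastLessThan_concat zero_le)
      also have "(\<Sum>k\<in>{n..<L}. g M ((T ^^ k) x)) = (\<Sum>k<L - n. g M ((T ^^ (k + n)) x))"
        using sum.shift_bounds_nat_ivl[of "\<lambda>k. g M ((T ^^ k) x)" 0 n "L - n"] that
        by (simp add: atLeast0LessThan)
      finally show ?thesis by (simp add: funpow_add)
    qed
    have step: ?case if "1 \<le> n" "n \<le> L" "(\<Sum>k<n. g M ((T ^^ k) x)) \<le> e * real n" for n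
    proof -
      have "(\<Sum>k<L - n. g M ((T ^^ k) ((T ^^ n) x))) \<le> e * real (L - n) + real M"
        using less[of "L - n"] that by simp
      then show ?thesis using split[OF that(2)] that by (simp add: of_nat_diff algebra_simps)
    qed
    consider "L = 0" | "L > 0" "x \<notin> G M" | n where "x \<in> G M" "n \<in> {1..M}" "S n x \<le> e * real n"
      unfolding G_def by blast
    then show ?case
    proof cases
      case 2
      then show ?thesis using step[of 1] e by (simp add: g_def)
    next
      case 3
      show ?thesis
      proof (cases "n \<le> L")
        case True
        have "(\<Sum>k<n. g M ((T ^^ k) x)) \<le> S n x" unfolding S_def by (intro sum_mono g)
        then show ?thesis using 3 True step[of n] by simp
      next
        case False
        have "(\<Sum>k<L. g M ((T ^^ k) x)) \<le> (\<Sum>k<L. 1)" by (intro sum_mono g)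
        moreover have "0 \<le> e * real L" using e by simp
        ultimately show ?thesis using False 3(2) by simp
      qed
    qed simp
  qed
  have int_comp: "(\<integral>x. h ((T ^^ k) x) \<partial>m) = (\<integral>x. h x \<partial>m)"
    if [measurable]: "h \<in> borel_measurable m" for h :: "'a \<Rightarrow> real" and k
  proof (induction k)
    case (Suc k)
    have "(\<integral>x. h ((T ^^ Suc k) x) \<partial>m) = (\<integral>x. h ((T ^^ k) (T x)) \<partial>m)"
      by (simp add: funpow_swap1)
    also have "\<dots> = (\<integral>x. h ((T ^^ k) x) \<partial>distr m m T)"
      by (subst integral_distr) auto
    finally show ?case using Suc T by simp
  qed simp
  have gi: "(\<integral>x. g M x \<partial>m) \<le> e" for M
  proof (rule field_le_epsilon)
    fix d :: real assume "d > 0"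
    obtain L :: nat where L: "L > 0" "real M / d < real L"
      by (metis gr0I reals_Archimedean2 of_nat_0 \<open>d > 0\<close> divide_nonneg_pos of_nat_0_le_iff not_le)
    have gint: "integrable m (\<lambda>x. g M ((T ^^ k) x))" for k
    proof (rule integrable_const_bound[of _ 1])
      show "AE x in m. norm (g M ((T ^^ k) x)) \<le> 1" using g by (intro AE_I2) (simp add: abs_of_nonneg)
    qed measurable
    have "real L * (\<integral>x. g M x \<partial>m) = (\<Sum>k<L. (\<integral>x. g M ((T ^^ k) x) \<partial>m))"
      by (simp add: int_comp)
    also have "\<dots> = (\<integral>x. (\<Sum>k<L. g M ((T ^^ k) x)) \<partial>m)"
      using gint by (simp add: Bochner_Integration.integral_sum)
    also have "\<dots> \<le> (\<integral>x. e * real L + real M \<partial>m)"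
      using gint bound by (intro integral_mono) auto
    also have "\<dots> = e * real L + real M" using prob_space by simp
    also have "\<dots> \<le> real L * (e + d)" using L \<open>d > 0\<close> by (simp add: field_simps)
    finally show "(\<integral>x. g M x \<partial>m) \<le> e + d" using L by (simp add: mult_le_cancel_left_pos)
  qed
  have "(\<lambda>M. \<integral>x. g M x \<partial>m) \<longlonglongrightarrow> (\<integral>x. f x \<partial>m)"
  proof (rule integral_dominated_convergence[of _ _ _ "\<lambda>_. 1"])
    show "AE x in m. (\<lambda>M. g M x) \<longlonglongrightarrow> f x"
      using cover
    proof eventually_elim
      case (elim x)
      then obtain n where n: "n \<ge> 1" "S n x \<le> e * real n" by (auto simp: S_def)
      then have "x \<in> G M" if "M \<ge> n" for M
        using that unfolding G_def by auto
      then have "g M x = f x" if "M \<ge> n" for M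
        using that by (simp add: g_def)
      then show ?case by (intro tendsto_eventually eventually_sequentiallyI)
    qed
  qed (use g in \<open>auto simp: abs_le_iff\<close>)
  then show ?thesis by (rule LIMSEQ_le_const2) (use gi in auto)
qed


section \<open>Occupation times\<close>

definition visits :: "'a set \<Rightarrow> 'a \<Rightarrow> real set" where
  "visits B \<omega> = {s. \<sigma> s \<omega> \<in> B}"

text \<open>The interval is half open so that consecutive time intervals are disjoint and occupation times
  add up exactly.\<close>

definition occupation :: "'a set \<Rightarrow> 'a \<Rightarrow> real \<Rightarrow> real" where
  "occupation B \<omega> t = measure lborel ({0..<t} \<inter> visits B \<omega>)"

lemma visits_measurable [measurable]:
  assumes [measurable]: "B \<in> sets m"
  shows "visits B \<omega> \<in> sets borel"
proof -
  have "(\<lambda>s. \<sigma> s \<omega>) \<in> measurable borel borel"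
    by (intro borel_measurable_continuous_onI continuous_intros)
  from measurable_sets[OF this, of B] show ?thesis
    using assms by (simp add: visits_def sets_m vimage_def)
qed

lemma fmeasurable_bounded: "bounded S \<Longrightarrow> S \<in> sets borel \<Longrightarrow> S \<in> fmeasurable lborel"
  for S :: "real set"
  by (intro fmeasurableI emeasure_bounded_finite) auto

lemma fmeasurable_interval_visits:
  assumes "B \<in> sets m"
  shows "{s..<t} \<inter> visits B \<omega> \<in> fmeasurable lborel"
  using assms by (intro fmeasurable_bounded bounded_Int disjI1) auto

lemma measure_visits_shift:
  assumes B: "B \<in> sets m"
  shows "measure lborel ({s..<s + t} \<inter> visits B \<omega>) = occupation B (\<sigma> s \<omega>) t"
proof -
  have "measure lborel ({s..<s + t} \<inter> visits B \<omega>) = measure (distr lborel borel ((+) s)) ({s..<s + t} \<inter> visits B \<omega>)"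
    by (simp add: lborel_distr_plus)
  also have "\<dots> = measure lborel ((+) s -` ({s..<s + t} \<inter> visits B \<omega>))"
    using B by (subst measure_distr) auto
  also have "(+) s -` ({s..<s + t} \<inter> visits B \<omega>) = {0..<t} \<inter> visits B (\<sigma> s \<omega>)"
    by (auto simp: visits_def flow_flow)
  finally show ?thesis by (simp add: occupation_def)
qed

lemma occupation_nonneg [simp]: "occupation B \<omega> t \<ge> 0"
  by (simp add: occupation_def)

lemma occupation_le:
  assumes "B \<in> sets m" "t \<ge> 0"
  shows "occupation B \<omega> t \<le> t"
proof -
  have "occupation B \<omega> t \<le> measure lborel {0..t}"
    unfolding occupation_def using assms
    by (intro measure_mono_fmeasurable) (auto intro: fmeasurable_bounded)
  then show ?thesis using assms by simp
qed

lemma occupation_add: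
  assumes B: "B \<in> sets m" and "s \<ge> 0" "t \<ge> 0"
  shows "occupation B \<omega> (s + t) = occupation B \<omega> s + occupation B (\<sigma> s \<omega>) t"
proof -
  have "{0..<s + t} \<inter> visits B \<omega> = ({0..<s} \<inter> visits B \<omega>) \<union> ({s..<s + t} \<inter> visits B \<omega>)"
    using assms by auto
  moreover have "({0..<s} \<inter> visits B \<omega>) \<inter> ({s..<s + t} \<inter> visits B \<omega>) = {}" by auto
  ultimately show ?thesis
    using measure_Un2[OF fmeasurable_interval_visits[OF B] fmeasurable_interval_visits[OF B], of 0 s \<omega> s "s + t" \<omega>]
    unfolding measure_visits_shift[OF B, symmetric] unfolding occupation_def
    by (simp add: Diff_triv Int_commute)
qed

text \<open>Shifting the starting point by \<open>t\<close> moves the time window, which loses a set of length at most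
  \<open>\<bar>t\<bar>\<close>.\<close>

lemma occupation_flow:
  assumes B: "B \<in> sets m" and "n \<ge> 0"
  shows "occupation B \<omega> n \<le> occupation B (\<sigma> t \<omega>) n + \<bar>t\<bar>"
proof -
  have "occupation B \<omega> n \<le> measure lborel (({t..<t + n} \<inter> visits B \<omega>) \<union> ({0..<t} \<union> {t + n..<n}))"
    unfolding occupation_def using B
    by (intro measure_mono_fmeasurable fmeasurable.Un fmeasurable_interval_visits)
       (auto intro: fmeasurable_bounded)
  also have "\<dots> \<le> measure lborel ({t..<t + n} \<inter> visits B \<omega>) + measure lborel ({0..<t} \<union> {t + n..<n})"
    using B by (intro measure_Un_le) auto
  also have "measure lborel ({0..<t} \<union> {t + n..<n}) \<le> \<bar>t\<bar>"
    using measure_Un_le[of "{0..<t}" lborel "{t + n..<n}"] \<open>n \<ge> 0\<close> by (cases "t \<ge> 0") auto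
  finally show ?thesis using measure_visits_shift[OF B] by simp
qed

lemma flow_funpow: "(\<sigma> 1 ^^ k) \<omega> = \<sigma> (real k) \<omega>"
  by (induction k) (auto simp: flow_flow add.commute)

lemma sum_occupation:
  assumes B: "B \<in> sets m"
  shows "(\<Sum>k<n. occupation B ((\<sigma> 1 ^^ k) \<omega>) 1) = occupation B \<omega> (real n)"
proof (induction n)
  case 0
  then show ?case by (simp add: occupation_def)
next
  case (Suc n)
  then show ?case
    using occupation_add[OF B, of "real n" 1 \<omega>] by (simp add: flow_funpow add.commute)
qed

text \<open>Both facts come from slicing \<open>{(\<omega>, s). 0 \<le> s < t \<and> \<sigma> s \<omega> \<in> B}\<close>: its slices at a fixed \<open>\<omega>\<close> are
  visit sets, its slices at a fixed time in \<open>{0..<t}\<close> are preimages of \<open>B\<close>,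
  all of the measure of \<open>B\<close>.\<close>

lemma
  assumes B [measurable]: "B \<in> sets m"
  shows occupation_measurable: "(\<lambda>\<omega>. occupation B \<omega> t) \<in> borel_measurable m"
    and integral_occupation: "(\<integral>\<omega>. occupation B \<omega> 1 \<partial>m) = measure m B"
proof -
  interpret P: pair_sigma_finite m lborel ..
  define Q where "Q t = {x \<in> space (m \<Otimes>\<^sub>M lborel). snd x \<in> {0..<t} \<and> (\<lambda>(\<omega>, s). \<sigma> s \<omega>) x \<in> B}" for t :: real
  note flow_joint_measurable [measurable]
  have Q [measurable]: "Q t \<in> sets (m \<Otimes>\<^sub>M lborel)" for t
    unfolding Q_def by measurable
  have slice: "Pair \<omega> -` Q t = {0..<t} \<inter> visits B \<omega>" for \<omega> t
    by (auto simp: Q_def space_pair_measure visits_def)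
  have occ: "occupation B \<omega> t = enn2real (emeasure lborel (Pair \<omega> -` Q t))" for \<omega> t
    by (simp add: occupation_def measure_def slice)
  show meas: "(\<lambda>\<omega>. occupation B \<omega> t) \<in> borel_measurable m" for t
    unfolding occ using P.measurable_emeasure_Pair1[OF Q] by measurable
  have "(\<integral>\<^sup>+\<omega>. ennreal (occupation B \<omega> 1) \<partial>m) = (\<integral>\<^sup>+\<omega>. emeasure lborel (Pair \<omega> -` Q 1) \<partial>m)"
    using fmeasurableD2[OF fmeasurable_interval_visits[OF B, of 0 1]]
    by (intro nn_integral_cong) (simp add: occ slice top.not_eq_extremum)
  also have "\<dots> = emeasure (m \<Otimes>\<^sub>M lborel) (Q 1)"
    by (intro lborel.emeasure_pair_measure_alt[symmetric] Q)
  also have "\<dots> = (\<integral>\<^sup>+s. emeasure m ((\<lambda>\<omega>. (\<omega>, s)) -` Q 1) \<partial>lborel)"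
    by (intro P.emeasure_pair_measure_alt2 Q)
  also have "\<dots> = (\<integral>\<^sup>+s. emeasure m B * indicator {0..<1::real} s \<partial>lborel)"
  proof (intro nn_integral_cong)
    fix s :: real
    have "(\<lambda>\<omega>. (\<omega>, s)) -` Q 1 = (if s \<in> {0..<1} then \<sigma> s -` B else {})"
      by (auto simp: Q_def space_pair_measure)
    then show "emeasure m ((\<lambda>\<omega>. (\<omega>, s)) -` Q 1) = emeasure m B * indicator {0..<1} s"
      using emeasure_vimage[OF B] by simp
  qed
  also have "\<dots> = emeasure m B"
    by (simp add: nn_integral_cmult)
  finally show "(\<integral>\<omega>. occupation B \<omega> 1 \<partial>m) = measure m B"
    using meas by (subst integral_eq_nn_integral) (auto simp: measure_def)
qed

end

section \<open>Positive lower density of visits\<close>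

locale ergodic_flow = invariant_measure +
  assumes ergodic: "\<And>B. B \<in> sets m \<Longrightarrow> flow_invariant \<sigma> B \<Longrightarrow> measure m B = 0 \<or> measure m B = 1"
begin

text \<open>The set \<open>G\<close> of points with occupation times growing at least linearly is invariant, because a
  shift changes occupation times by a bounded amount, so its measure is \<open>0\<close> or \<open>1\<close>.  In the first
  case almost every point has, for every \<open>e > 0\<close>, a block of average at most \<open>e\<close>, and the covering
  argument gives \<open>measure m B \<le> e\<close>.\<close>

lemma AE_linear_occupation:
  assumes B: "B \<in> sets m" and pos: "measure m B > 0"
  shows "AE \<omega> in m. \<exists>k N::nat. \<forall>n\<ge>N. real n \<le> real k * occupation B \<omega> (real n)"
proof -
  define G where "G = {\<omega>. \<exists>k N::nat. \<forall>n\<ge>N. real n \<le> real k * occupation B \<omega> (real n)}"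
  note occupation_measurable[OF B, measurable]
  have "{\<omega>\<in>space m. \<exists>k N::nat. \<forall>n\<ge>N. real n \<le> real k * occupation B \<omega> (real n)} \<in> sets m"
    by measurable
  then have G: "G \<in> sets m" by (simp add: G_def)
  have "flow_invariant \<sigma> G"
  proof (rule flow_invariantI)
    fix \<omega> t assume "\<omega> \<in> G"
    then obtain k N where kN: "\<And>n. n \<ge> N \<Longrightarrow> real n \<le> real k * occupation B \<omega> (real n)"
      unfolding G_def by blast
    \<comment> \<open>The slope is halved to \<open>1 / (2 * k)\<close>, and from time \<open>N'\<close> on this absorbs the loss \<open>\<bar>t\<bar>\<close>.\<close>
    obtain N' :: nat where N': "2 * real k * \<bar>t\<bar> \<le> real N'" using real_arch_simple by blast
    have "real n \<le> real (2 * k) * occupation B (\<sigma> t \<omega>) (real n)" if n: "n \<ge> max N N'" for n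
    proof -
      have "2 * real n \<le> 2 * real k * occupation B \<omega> (real n)" using kN[of n] n by simp
      also have "\<dots> \<le> 2 * real k * (occupation B (\<sigma> t \<omega>) (real n) + \<bar>t\<bar>)"
        by (intro mult_left_mono occupation_flow B) auto
      also have "\<dots> \<le> 2 * real k * occupation B (\<sigma> t \<omega>) (real n) + real n"
        using N' n by (simp add: algebra_simps)
      finally show ?thesis by simp
    qed
    then show "\<sigma> t \<omega> \<in> G" unfolding G_def by blast
  qed
  with ergodic[OF G] consider "measure m G = 0" | "measure m G = 1" by blast
  then show ?thesis
  proof cases
    case 1
    then have "AE \<omega> in m. \<omega> \<notin> G"
      using G by (simp add: AE_iff_measurable[of G] emeasure_eq_measure)
    have "measure m B \<le> 0 + e" if "e > 0" for e
    proof -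
      have "AE \<omega> in m. \<exists>n\<ge>1. (\<Sum>k<n. occupation B ((\<sigma> 1 ^^ k) \<omega>) 1) \<le> e * real n"
        using \<open>AE \<omega> in m. \<omega> \<notin> G\<close>
      proof eventually_elim
        case (elim \<omega>)
        obtain k :: nat where k: "k > 0" "inverse (real k) < e"
          using ex_inverse_of_nat_less[OF \<open>e > 0\<close>] by blast
        obtain n where n: "n \<ge> 1" "real k * occupation B \<omega> (real n) < real n"
          using elim unfolding G_def mem_Collect_eq not_ex not_all not_imp not_le by blast
        have "occupation B \<omega> (real n) \<le> inverse (real k) * real n"
          using n k by (simp add: field_simps)
        also have "\<dots> \<le> e * real n" using k by (intro mult_right_mono) auto
        finally show ?case using n by (auto simp: sum_occupation[OF B])
      qed
      then have "(\<integral>\<omega>. occupation B \<omega> 1 \<partial>m) \<le> e"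
        using that distr_m occupation_le[OF B, of 1] occupation_measurable[OF B]
        by (intro covering_average_le[of "\<sigma> 1"]) auto
      then show ?thesis by (simp add: integral_occupation[OF B])
    qed
    then have "measure m B \<le> 0" by (rule field_le_epsilon)
    then show ?thesis using pos by simp
  next
    case 2
    then have "AE \<omega> in m. \<omega> \<in> G" using G prob_eq_1 by blast
    then show ?thesis by (simp add: G_def)
  qed
qed

text \<open>Stating the previous result at the points of \<open>B\<close> only makes it hold for null sets too, so it can
  be used for a whole countable family of sets at once.\<close>

lemma AE_recurrent_linear_occupation:
  assumes B: "B \<in> sets m"
  shows "AE \<omega> in m. \<omega> \<in> B \<longrightarrow> (\<exists>k N::nat. \<forall>n\<ge>N. real n \<le> real k * occupation B \<omega> (real n))"
proof (cases "measure m B > 0")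
  case True
  from AE_linear_occupation[OF B this] show ?thesis by eventually_elim simp
next
  case False
  then have "B \<in> null_sets m"
    using B by (auto simp: null_sets_def emeasure_eq_measure zero_less_measure_iff)
  then have "AE \<omega> in m. \<omega> \<notin> B" by (rule AE_not_in)
  then show ?thesis by eventually_elim simp
qed

text \<open>The passage from integer times \<open>n\<close> to real times \<open>t\<close>, with \<open>n = \<lfloor>t\<rfloor>\<close>, costs a factor \<open>2\<close>, since
  \<open>t \<le> 2 * n\<close> once \<open>t \<ge> 2\<close>.\<close>

lemma lower_density_visits_pos:
  assumes B: "B \<in> sets m"
    and kN: "\<And>n. n \<ge> N \<Longrightarrow> real n \<le> real k * occupation B \<omega> (real n)"
    and C: "C \<in> sets lebesgue" "{0..} \<inter> visits B \<omega> \<subseteq> C"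
  shows "lower_density C > 0"
proof -
  have k: "k > 0"
    using kN[of "Suc N"] by (cases "k = 0") auto
  have "\<forall>\<^sub>F t in at_top. ereal (1 / (2 * real k)) \<le> ereal (1 / t * measure lebesgue ({0..t} \<inter> C))"
  proof (rule eventually_at_top_linorderI[of "real N + 2"])
    fix t :: real assume t: "real N + 2 \<le> t"
    define n where "n = nat \<lfloor>t\<rfloor>"
    have n: "n \<ge> N" "real n \<le> t" "t \<le> 2 * real n" unfolding n_def using t by linarith+
    have "t \<le> 2 * (real k * occupation B \<omega> (real n))" using kN[OF n(1)] n by simp
    also have "occupation B \<omega> (real n) = measure lebesgue ({0..<real n} \<inter> visits B \<omega>)"
      using B by (simp add: occupation_def)
    also have "\<dots> \<le> measure lebesgue ({0..t} \<inter> C)"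
    proof (rule measure_mono_fmeasurable)
      show "{0..<real n} \<inter> visits B \<omega> \<subseteq> {0..t} \<inter> C" using n C(2) by auto
      show "{0..<real n} \<inter> visits B \<omega> \<in> sets lebesgue"
        by (intro sets_completionI_sets) (simp add: visits_measurable[OF B] sets.Int)
      show "{0..t} \<inter> C \<in> lmeasurable"
        by (rule bounded_set_imp_lmeasurable)
           (use C(1) in \<open>auto intro: bounded_Int sets.Int\<close>)
    qed
    finally have "t \<le> 2 * (real k * measure lebesgue ({0..t} \<inter> C))"
      using k by simp
    then show "ereal (1 / (2 * real k)) \<le> ereal (1 / t * measure lebesgue ({0..t} \<inter> C))"
      using t k by (simp add: field_simps)
  qed
  then have "ereal (1 / (2 * real k)) \<le> lower_density C"
    unfolding lower_density_def by (rule Liminf_bounded)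
  moreover have "0 < ereal (1 / (2 * real k))" using k by simp
  ultimately show ?thesis by (rule less_le_trans[rotated])
qed

end

section \<open>Cocycles of mean zero over an ergodic flow\<close>

locale ergodic_cocycle = ergodic_flow \<sigma> m + cocycle_flow \<sigma> a
  for \<sigma> :: "real \<Rightarrow> 'a::metric_space \<Rightarrow> 'a" and m a
begin

lemma H_measurable [measurable]: "H \<in> borel_measurable m"
  unfolding borel_measurable_iff_less using open_in_sets[OF open_H_less] by simp

lemma A_measurable [measurable]: "(\<lambda>\<omega>. A \<omega> t) \<in> borel_measurable m"
  by (intro continuous_measurable continuous_on_A)

lemma integrable_A: "integrable m (\<lambda>\<omega>. A \<omega> 1)"
proof -
  obtain K where K: "\<And>\<omega>. \<bar>a \<omega>\<bar> \<le> K" using a_bounded by blast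
  show ?thesis
    using A_le[OF K, of 1] by (intro integrable_const_bound[of _ K]) auto
qed

lemma integral_A:
  assumes "(\<integral>\<omega>. a \<omega> \<partial>m) = 0"
  shows "(\<integral>\<omega>. A \<omega> 1 \<partial>m) = 0"
proof -
  interpret P: pair_sigma_finite m lborel ..
  obtain K where K: "\<And>\<omega>. \<bar>a \<omega>\<bar> \<le> K" using a_bounded by blast
  note flow_joint_measurable [measurable] continuous_measurable[OF continuous_a, measurable]
  have A: "A \<omega> 1 = (\<integral>s. indicator {0..1} s * a (\<sigma> s \<omega>) \<partial>lborel)" for \<omega>
    unfolding orbit_integral_def
    by (subst interval_integral_Icc) (auto simp: set_lebesgue_integral_def)
  have meas: "(\<lambda>x. indicator {0..1} (snd x) * a ((\<lambda>(\<omega>, s). \<sigma> s \<omega>) x)) \<in> borel_measurable (m \<Otimes>\<^sub>M lborel)"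
    by measurable
  have "integrable (m \<Otimes>\<^sub>M lborel) (\<lambda>(\<omega>, s). indicator {0..1} s * a (\<sigma> s \<omega>))"
  proof (rule integrableI_bounded_set[of "UNIV \<times> {0..1}" _ _ K])
    show "UNIV \<times> {0..1::real} \<in> sets (m \<Otimes>\<^sub>M lborel)"
      using sets.top[of m] by (intro pair_measureI) auto
    have "emeasure (m \<Otimes>\<^sub>M lborel) (UNIV \<times> {0..1::real}) = emeasure m UNIV * emeasure lborel {0..1::real}"
      using sets.top[of m] by (intro lborel.emeasure_pair_measure_Times) auto
    then show "emeasure (m \<Otimes>\<^sub>M lborel) (UNIV \<times> {0..1::real}) < \<infinity>"
      using emeasure_space_1 by simp
  qed (use K meas in \<open>auto simp: case_prod_unfold indicator_def\<close>)
  from P.Fubini_integral[OF this]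
  have "(\<integral>\<omega>. A \<omega> 1 \<partial>m) = (\<integral>s. (\<integral>\<omega>. indicator {0..1} s * a (\<sigma> s \<omega>) \<partial>m) \<partial>lborel)"
    by (simp add: A)
  also have "\<dots> = (\<integral>s. indicator {0..1::real} s * (\<integral>\<omega>. a \<omega> \<partial>distr m m (\<sigma> s)) \<partial>lborel)"
    by (subst integral_distr) auto
  finally show ?thesis using assms by (simp add: distr_m)
qed

text \<open>Let \<open>s \<omega>\<close> be the supremum of \<open>A \<omega>\<close> over the past.  It need not be integrable, so the identity
  \<open>\<integral>s (\<sigma> 1 \<omega>) = \<integral>s \<omega>\<close> is used only for the bounded truncations \<open>S N\<close>.  Their increments are at
  least \<open>- K\<close>, where \<open>K\<close> bounds \<open>\<bar>A \<omega> 1\<bar>\<close>, so Fatou's lemma bounds the integral of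
  \<open>s (\<sigma> 1 \<omega>) - s \<omega> + K\<close> by \<open>K\<close>.  This function dominates \<open>K - A \<omega> 1\<close>, whose integral is \<open>K\<close>,
  so the two agree almost everywhere.  Iterating along integer times bounds \<open>A \<omega>\<close> by \<open>s \<omega>\<close>.\<close>

lemma AE_bounded_above:
  assumes mean: "(\<integral>\<omega>. a \<omega> \<partial>m) = 0"
    and past: "AE \<omega> in m. \<exists>C. \<forall>t\<le>0. A \<omega> t \<le> C"
  shows "AE \<omega> in m. \<exists>C. \<forall>t. A \<omega> t \<le> C"
proof -
  obtain K where K: "K \<ge> 0" "\<And>\<omega>. \<bar>a \<omega>\<bar> \<le> K" using a_bounded by blast
  have AK: "\<bar>A \<omega> 1\<bar> \<le> K" for \<omega> using A_le[OF K(2), of 1] by simp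
  define S where "S N \<omega> = (SUP t\<in>{..0}. min (A \<omega> t) (real N))" for N \<omega>
  have bdd: "bdd_above ((\<lambda>t. min (A \<omega> t) (real N)) ` {..0})" for N \<omega>
    by (rule bdd_aboveI2[of _ _ "real N"]) simp
  have less_S: "c < S N \<omega> \<longleftrightarrow> (\<exists>t\<le>0. c < A \<omega> t \<and> c < real N)" for c N \<omega>
    unfolding S_def using bdd by (subst less_cSUP_iff) auto
  have S_nonneg: "0 \<le> S N \<omega>" for N \<omega>
    unfolding S_def using cSUP_upper[OF _ bdd, of 0] by fastforce
  have S_le: "S N \<omega> \<le> real N" for N \<omega>
    unfolding S_def by (intro cSUP_least) auto
  have [measurable]: "S N \<in> borel_measurable m" for N
    unfolding borel_measurable_iff_greater
  proof
    fix c
    have "{\<omega>. c < S N \<omega>} = (\<Union>t\<in>{..0}. {\<omega>. c < A \<omega> t \<and> c < real N})" by (auto simp: less_S)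
    also have "open \<dots>"
      using open_A_greater by (cases "c < real N") auto
    finally show "{\<omega> \<in> space m. c < S N \<omega>} \<in> sets m" by (simp add: open_in_sets)
  qed
  have S_step: "S N \<omega> \<le> S N (\<sigma> 1 \<omega>) + K" for N \<omega>
    unfolding S_def[of N \<omega>]
  proof (rule cSUP_least)
    fix t :: real assume "t \<in> {..0}"
    then have "min (A (\<sigma> 1 \<omega>) (t - 1)) (real N) \<le> S N (\<sigma> 1 \<omega>)"
      unfolding S_def by (intro cSUP_upper bdd) auto
    then show "min (A \<omega> t) (real N) \<le> S N (\<sigma> 1 \<omega>) + K"
      using AK[of \<omega>] K(1) by (auto simp: A_shift min_def split: if_splits)
  qed simp
  have S_int: "integrable m (S N)" for N
    using S_nonneg S_le by (intro integrable_const_bound[of _ "real N"]) auto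
  have S_int': "integrable m (\<lambda>\<omega>. S N (\<sigma> 1 \<omega>))" for N
    using S_nonneg S_le by (intro integrable_const_bound[of _ "real N"]) auto
  define u where "u N \<omega> = S N (\<sigma> 1 \<omega>) - S N \<omega> + K" for N \<omega>
  have [measurable]: "u N \<in> borel_measurable m" for N unfolding u_def by measurable
  have "(\<integral>\<^sup>+\<omega>. ennreal (u N \<omega>) \<partial>m) = ennreal K" for N
  proof -
    have "(\<integral>\<omega>. S N (\<sigma> 1 \<omega>) \<partial>m) = (\<integral>\<omega>. S N \<omega> \<partial>distr m m (\<sigma> 1))"
      by (subst integral_distr) auto
    then have "(\<integral>\<omega>. u N \<omega> \<partial>m) = K"
      unfolding u_def using S_int S_int' prob_space by (simp add: distr_m)
    moreover have "integrable m (u N)" unfolding u_def using S_int S_int' by simp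
    moreover have "AE \<omega> in m. 0 \<le> u N \<omega>" using S_step by (intro AE_I2) (simp add: u_def algebra_simps)
    ultimately show ?thesis by (simp add: nn_integral_eq_integral)
  qed
  then have fatou: "(\<integral>\<^sup>+\<omega>. liminf (\<lambda>N. ennreal (u N \<omega>)) \<partial>m) \<le> ennreal K"
    using nn_integral_liminf[of "\<lambda>N \<omega>. ennreal (u N \<omega>)" m] by (simp add: Liminf_const)
  define s where "s \<omega> = (SUP t\<in>{..0}. A \<omega> t)" for \<omega>
  have s_eventually: "\<forall>\<^sub>F N in sequentially. S N \<omega> = s \<omega>" if "\<forall>t\<le>0. A \<omega> t \<le> C" for \<omega> C
  proof -
    obtain N where N: "C \<le> real N" using real_arch_simple by blast
    have "min (A \<omega> t) (real M) = A \<omega> t" if "t \<le> 0" "M \<ge> N" for t M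
    proof -
      have "A \<omega> t \<le> real M" using \<open>\<forall>t\<le>0. A \<omega> t \<le> C\<close> that N by (meson of_nat_le_iff order_trans)
      then show ?thesis by simp
    qed
    then have "S M \<omega> = s \<omega>" if "M \<ge> N" for M
      unfolding S_def s_def using that by (intro SUP_cong) auto
    then show ?thesis by (rule eventually_sequentiallyI)
  qed
  have s_upper: "A \<omega> t \<le> s \<omega>" if "\<forall>t\<le>0. A \<omega> t \<le> C" "t \<le> 0" for \<omega> t C
    unfolding s_def using that by (intro cSUP_upper bdd_aboveI2[of _ _ C]) auto
  have past1: "AE \<omega> in m. \<exists>C. \<forall>t\<le>0. A (\<sigma> t' \<omega>) t \<le> C" for t' by (rule AE_flow[OF past])
  have lim: "AE \<omega> in m. liminf (\<lambda>N. ennreal (u N \<omega>)) = ennreal (s (\<sigma> 1 \<omega>) - s \<omega> + K)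
      \<and> 0 \<le> s (\<sigma> 1 \<omega>) - s \<omega> + A \<omega> 1"
    using past past1[of 1]
  proof eventually_elim
    case (elim \<omega>)
    obtain C C' where C: "\<forall>t\<le>0. A \<omega> t \<le> C" "\<forall>t\<le>0. A (\<sigma> 1 \<omega>) t \<le> C'" using elim by blast
    have "\<forall>\<^sub>F N in sequentially. ennreal (u N \<omega>) = ennreal (s (\<sigma> 1 \<omega>) - s \<omega> + K)"
      using s_eventually[OF C(1)] s_eventually[OF C(2)]
      by eventually_elim (simp add: u_def)
    then have "liminf (\<lambda>N. ennreal (u N \<omega>)) = ennreal (s (\<sigma> 1 \<omega>) - s \<omega> + K)"
      by (intro lim_imp_Liminf tendsto_eventually) auto
    moreover have "s \<omega> \<le> s (\<sigma> 1 \<omega>) + A \<omega> 1"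
      unfolding s_def[of \<omega>]
    proof (rule cSUP_least)
      fix t :: real assume "t \<in> {..0}"
      then have "A (\<sigma> 1 \<omega>) (t - 1) \<le> s (\<sigma> 1 \<omega>)" by (intro s_upper[OF C(2)]) auto
      then show "A \<omega> t \<le> s (\<sigma> 1 \<omega>) + A \<omega> 1" by (simp add: A_shift)
    qed simp
    ultimately show ?case by simp
  qed
  have step: "AE \<omega> in m. s (\<sigma> 1 \<omega>) + A \<omega> 1 \<le> s \<omega>"
  proof -
    let ?f = "\<lambda>\<omega>. liminf (\<lambda>N. ennreal (u N \<omega>))" and ?g = "\<lambda>\<omega>. ennreal (K - A \<omega> 1)"
    have "(\<integral>\<omega>. K - A \<omega> 1 \<partial>m) = K"
      using integrable_A integral_A[OF mean] prob_space by simp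
    moreover have "K - A \<omega> 1 \<ge> 0" for \<omega> using AK[of \<omega>] by simp
    ultimately have g: "(\<integral>\<^sup>+\<omega>. ?g \<omega> \<partial>m) = ennreal K"
      using integrable_A by (subst nn_integral_eq_integral) auto
    have "AE \<omega> in m. ?g \<omega> \<le> ?f \<omega>" using lim
      by eventually_elim (auto intro!: ennreal_leI)
    then have "(\<integral>\<^sup>+\<omega>. ?f \<omega> - ?g \<omega> \<partial>m) = (\<integral>\<^sup>+\<omega>. ?f \<omega> \<partial>m) - (\<integral>\<^sup>+\<omega>. ?g \<omega> \<partial>m)"
      by (intro nn_integral_diff) (auto simp: g)
    also have "\<dots> = 0" using fatou le_less_trans[OF fatou] by (simp add: g diff_eq_0_iff_ennreal)
    finally have "AE \<omega> in m. ?f \<omega> - ?g \<omega> = 0" by (subst (asm) nn_integral_0_iff_AE) auto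
    then show ?thesis using lim
    proof eventually_elim
      case (elim \<omega>)
      then have "ennreal (s (\<sigma> 1 \<omega>) - s \<omega> + K) \<le> ennreal (K - A \<omega> 1)"
        by (auto simp: diff_eq_0_iff_ennreal top_unique)
      then show ?case using AK[of \<omega>] by (subst (asm) ennreal_le_iff) auto
    qed
  qed
  have "AE \<omega> in m. \<forall>n::nat. s (\<sigma> 1 (\<sigma> (real n) \<omega>)) + A (\<sigma> (real n) \<omega>) 1 \<le> s (\<sigma> (real n) \<omega>)"
    unfolding AE_all_countable using AE_flow[OF step] by blast
  moreover have "AE \<omega> in m. \<forall>n::nat. \<exists>C. \<forall>t\<le>0. A (\<sigma> (real n) \<omega>) t \<le> C"
    unfolding AE_all_countable using past1 by blast
  ultimately show ?thesis
  proof eventually_elim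
    case (elim \<omega>)
    have s_le: "s (\<sigma> (real n) \<omega>) + A \<omega> (real n) \<le> s \<omega>" for n :: nat
    proof (induction n)
      case (Suc n)
      then show ?case
        using elim(1)[rule_format, of n] by (simp add: flow_flow A_shift add.commute)
    qed simp
    have "A \<omega> t \<le> s \<omega>" for t
    proof -
      obtain n :: nat where n: "t \<le> real n" using real_arch_simple by blast
      obtain C where "\<forall>t\<le>0. A (\<sigma> (real n) \<omega>) t \<le> C" using elim(2) by blast
      then have "A (\<sigma> (real n) \<omega>) (t - real n) \<le> s (\<sigma> (real n) \<omega>)"
        using n by (intro s_upper) auto
      then show ?thesis using s_le[of n] by (simp add: A_shift)
    qed
    then show ?case by blast
  qed
qed


text \<open>The exceptional null set must not depend on the level \<open>\<epsilon> * H \<omega>\<close> or \<open>(1 - \<epsilon>) * H \<omega>\<close>, which varies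
  with \<open>\<omega>\<close>; therefore the occupation results are first collected for countably many levels and then
  a suitable level is chosen for each \<open>\<omega>\<close>.\<close>

lemma AE_densities:
  assumes min: "minimal_flow \<sigma>" and a: "a \<in> R_class \<sigma> m" and \<epsilon>: "0 < \<epsilon>" "\<epsilon> < 1"
  shows "AE \<omega> in m. \<omega> \<in> Omega_set \<sigma> a \<and> lower_density (I_set \<sigma> a \<epsilon> \<omega>) > 0 \<and>
    relatively_dense (I_set \<sigma> a \<epsilon> \<omega>) \<and> lower_density (D_set \<sigma> a \<epsilon> \<omega>) > 0"
proof -
  have mean: "(\<integral>\<omega>. a \<omega> \<partial>m) = 0" and no_primitive: "\<not> has_continuous_primitive \<sigma> a"
    and past: "AE \<omega> in m. (SUP t\<in>{..0}. ereal (A \<omega> t)) < \<infinity>"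
    using a by (auto simp: R_class_def)
  from past have "AE \<omega> in m. \<exists>C. \<forall>t\<le>0. A \<omega> t \<le> C"
  proof eventually_elim
    case (elim \<omega>)
    moreover have "ereal (A \<omega> 0) \<le> (SUP t\<in>{..0}. ereal (A \<omega> t))" by (intro SUP_upper) simp
    ultimately obtain C where C: "(SUP t\<in>{..0}. ereal (A \<omega> t)) = ereal C"
      by (cases "SUP t\<in>{..0}. ereal (A \<omega> t)") auto
    have "ereal (A \<omega> t) \<le> ereal C" if "t \<le> 0" for t
      unfolding C[symmetric] using that by (intro SUP_upper) simp
    then show ?case by auto
  qed
  then have bounded: "AE \<omega> in m. \<exists>C. \<forall>t. A \<omega> t \<le> C"
    by (rule AE_bounded_above[OF mean])
  then have Omega: "AE \<omega> in m. \<omega> \<in> Omega_set \<sigma> a"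
    by eventually_elim (auto intro: Omega_set_if_bounded_above[OF min no_primitive])
  then obtain \<omega>\<^sub>0 where \<omega>\<^sub>0: "\<omega>\<^sub>0 \<in> Omega_set \<sigma> a"
    using AE_const by (metis (mono_tags, lifting) eventually_mono)
  have nonempty: "{\<omega>. H \<omega> < \<delta>} \<noteq> {}" if "\<delta> > 0" for \<delta>
  proof -
    have "(INF t\<in>{0..}. ereal (A \<omega>\<^sub>0 t)) < ereal (ln \<delta>)" using \<omega>\<^sub>0 by (simp add: Omega_set_def)
    then obtain t where "A \<omega>\<^sub>0 t < ln \<delta>" by (auto simp: INF_less_iff)
    then have "exp (A \<omega>\<^sub>0 t) < \<delta>" using that by (metis exp_less_mono exp_ln)
    \<comment> \<open>In the infimum defining \<open>H\<close> at \<open>\<sigma> t \<omega>\<^sub>0\<close>, the time \<open>- t\<close> leads back to \<open>\<omega>\<^sub>0\<close>.\<close>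
    moreover have "exp (- A (\<sigma> t \<omega>\<^sub>0) (- t)) = exp (A \<omega>\<^sub>0 t)" by (simp add: A_shift)
    ultimately have "H (\<sigma> t \<omega>\<^sub>0) < \<delta>" by (metis H_less_iff)
    then show ?thesis by blast
  qed
  let ?lin = "\<lambda>B \<omega>. \<exists>k N::nat. \<forall>n\<ge>N. real n \<le> real k * occupation B \<omega> (real n)"
  have "AE \<omega> in m. ?lin {\<omega>. H \<omega> < inverse (real (Suc j))} \<omega>" for j
    using nonempty[of "inverse (real (Suc j))"]
    by (intro AE_linear_occupation open_in_sets open_H_less positive_measure_of_open[OF min]) auto
  then have low: "AE \<omega> in m. \<forall>j. ?lin {\<omega>. H \<omega> < inverse (real (Suc j))} \<omega>"
    by (simp add: AE_all_countable)
  have level [measurable]: "{\<omega>. c \<le> H \<omega>} \<in> sets m" "{\<omega>. H \<omega> \<le> c} \<in> sets m" for c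
    using H_measurable[unfolded borel_measurable_iff_ge] H_measurable[unfolded borel_measurable_iff_le]
    by auto
  have high: "AE \<omega> in m. \<forall>q::rat. of_rat q \<le> H \<omega> \<longrightarrow> ?lin {\<omega>. of_rat q \<le> H \<omega>} \<omega>"
    unfolding AE_all_countable
    using AE_recurrent_linear_occupation[OF level(1)] by auto
  show ?thesis
    using bounded Omega low high
  proof eventually_elim
    case (elim \<omega>)
    obtain C where "\<And>t. A \<omega> t \<le> C" using elim(1) by blast
    then have pos: "H \<omega> > 0" by (rule H_pos)
    have I: "I_set \<sigma> a \<epsilon> \<omega> = {0..} \<inter> visits {\<eta>. H \<eta> \<le> \<epsilon> * H \<omega>} \<omega>"
      using pos by (auto simp: I_set_def visits_def divide_le_eq)
    have D: "D_set \<sigma> a \<epsilon> \<omega> = {0..} \<inter> visits {\<eta>. (1 - \<epsilon>) * H \<omega> \<le> H \<eta>} \<omega>"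
      using pos by (auto simp: D_set_def visits_def le_divide_eq)
    have leb: "{0..} \<inter> visits B \<omega> \<in> sets lebesgue" if "B \<in> sets m" for B
      by (intro sets_completionI_sets) (simp add: visits_measurable[OF that] sets.Int)
    obtain j where j: "inverse (real (Suc j)) < \<epsilon> * H \<omega>"
      using reals_Archimedean[of "\<epsilon> * H \<omega>"] \<epsilon> pos by auto
    obtain k N where kN: "\<And>n. n \<ge> N \<Longrightarrow> real n \<le> real k * occupation {\<omega>. H \<omega> < inverse (real (Suc j))} \<omega> (real n)"
      using elim(3) by blast
    have "lower_density (I_set \<sigma> a \<epsilon> \<omega>) > 0"
      unfolding I
    proof (rule lower_density_visits_pos[OF open_in_sets[OF open_H_less] kN])
      show "{0..} \<inter> visits {\<omega>. H \<omega> < inverse (real (Suc j))} \<omega> \<subseteq> {0..} \<inter> visits {\<eta>. H \<eta> \<le> \<epsilon> * H \<omega>} \<omega>"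
        using j unfolding visits_def by (auto simp del: of_nat_Suc)
    qed (auto intro: leb level)
    moreover have "relatively_dense (I_set \<sigma> a \<epsilon> \<omega>)"
    proof -
      have "0 < \<epsilon> * H \<omega>" using \<epsilon> pos by simp
      then obtain L where L: "L > 0" "\<And>\<eta> s. \<exists>t\<in>{s..s + L}. \<sigma> t \<eta> \<in> {\<xi>. H \<xi> < \<epsilon> * H \<omega>}"
        using minimal_bounded_gaps[OF min open_H_less nonempty] by metis
      have "\<exists>t\<in>{s..s + L}. t \<in> I_set \<sigma> a \<epsilon> \<omega>" if "s \<ge> 0" for s
      proof -
        obtain t where "t \<in> {s..s + L}" "H (\<sigma> t \<omega>) < \<epsilon> * H \<omega>" using L(2) by blast
        then show ?thesis using that unfolding I visits_def by (intro bexI[of _ t]) auto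
      qed
      then show ?thesis unfolding relatively_dense_def using L(1) by blast
    qed
    moreover have "lower_density (D_set \<sigma> a \<epsilon> \<omega>) > 0"
    proof -
      have "(1 - \<epsilon>) * H \<omega> < H \<omega>" using pos \<epsilon> by (simp add: mult_less_cancel_right2)
      then obtain q :: rat where q: "(1 - \<epsilon>) * H \<omega> < of_rat q" "of_rat q < H \<omega>"
        using of_rat_dense by blast
      obtain k N where kN: "\<And>n. n \<ge> N \<Longrightarrow> real n \<le> real k * occupation {\<omega>. of_rat q \<le> H \<omega>} \<omega> (real n)"
        using elim(4) q(2) by (meson less_imp_le)
      show ?thesis
        unfolding D
      proof (rule lower_density_visits_pos[OF level(1) kN])
        show "{0..} \<inter> visits {\<omega>. of_rat q \<le> H \<omega>} \<omega> \<subseteq> {0..} \<inter> visits {\<eta>. (1 - \<epsilon>) * H \<omega> \<le> H \<eta>} \<omega>"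
          using q unfolding visits_def by auto
      qed (auto intro: leb level)
    qed
    ultimately show ?case using elim(2) by blast
  qed
qed

end

theorem theorem2p16:
  fixes \<sigma> :: "real \<Rightarrow> 'a::metric_space \<Rightarrow> 'a"
    and m :: "'a measure"
    and a :: "'a \<Rightarrow> real"
  assumes "compact (UNIV :: 'a set)"
    and "minimal_flow \<sigma>"
    and "m \<in> ergodic_measures \<sigma>"
    and "a \<in> R_class \<sigma> m"
  shows "\<forall>\<epsilon>\<in>{0<..<1}. \<exists>\<Omega>\<epsilon>. \<Omega>\<epsilon> \<subseteq> Omega_set \<sigma> a \<and> \<Omega>\<epsilon> \<in> sets m \<and> measure m \<Omega>\<epsilon> = 1 \<and>
           (\<forall>\<omega>\<in>\<Omega>\<epsilon>.
              (lower_density (I_set \<sigma> a \<epsilon> \<omega>) > 0 \<and> relatively_dense (I_set \<sigma> a \<epsilon> \<omega>)) \<and>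
              lower_density (D_set \<sigma> a \<epsilon> \<omega>) > 0)"
proof
  fix \<epsilon> :: real assume \<epsilon>: "\<epsilon> \<in> {0<..<1}"
  have m: "prob_space m" "sets m = sets borel" "\<And>t. distr m m (\<sigma> t) = m"
    "\<And>B. B \<in> sets m \<Longrightarrow> flow_invariant \<sigma> B \<Longrightarrow> measure m B = 0 \<or> measure m B = 1"
    using assms(3) by (auto simp: ergodic_measures_def)
  interpret prob_space m by (rule m)
  interpret ergodic_cocycle \<sigma> m a
    using assms m by unfold_locales (auto simp: minimal_flow_def R_class_def)
  have "AE \<omega> in m. \<omega> \<in> Omega_set \<sigma> a \<and> lower_density (I_set \<sigma> a \<epsilon> \<omega>) > 0 \<and>
    relatively_dense (I_set \<sigma> a \<epsilon> \<omega>) \<and> lower_density (D_set \<sigma> a \<epsilon> \<omega>) > 0" (is "AE \<omega> in m. ?P \<omega>")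
    using \<epsilon> by (intro AE_densities assms) auto
  then obtain N where N: "N \<in> null_sets m" "{\<omega> \<in> space m. \<not> ?P \<omega>} \<subseteq> N"
    unfolding eventually_ae_filter by blast
  have "measure m (space m - N) = 1"
    using N(1) prob_compl[of N] by (auto simp: measure_eq_0_null_sets)
  moreover have "\<omega> \<in> space m - N \<Longrightarrow> ?P \<omega>" for \<omega> using N(2) by blast
  ultimately show "\<exists>\<Omega>\<epsilon>. \<Omega>\<epsilon> \<subseteq> Omega_set \<sigma> a \<and> \<Omega>\<epsilon> \<in> sets m \<and> measure m \<Omega>\<epsilon> = 1 \<and>
           (\<forall>\<omega>\<in>\<Omega>\<epsilon>.
              (lower_density (I_set \<sigma> a \<epsilon> \<omega>) > 0 \<and> relatively_dense (I_set \<sigma> a \<epsilon> \<omega>)) \<and>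
              lower_density (D_set \<sigma> a \<epsilon> \<omega>) > 0)"
    using N(1) by (intro exI[of _ "space m - N"]) auto
qed

end
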